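(* Let $\mathcal A$ be a unital $W^*$-algebra and let $T:l^2(\mathcal A)\to l^2(\mathcal A)$ be a "compact" operator, i.e. an operator in the operator-norm closure of the linear span of the operators $\Theta_{y,z}:x\mapsto z\langle y,x\rangle$, $y,z\in l^2(\mathcal A)$. Then $T$ is compact, i.e. $T$ maps every norm bounded subset of $l^2(\mathcal A)$ to a set that is totally bounded in the topology $\tau$.
   Context: For a unital $W^*$-algebra $\mathcal A$, the standard Hilbert module is the right $\mathcal A$-module $l^2(\mathcal A)$ of all sequences $x=(\xi_1,\xi_2,\dots)$ in $\mathcal A$ such that $\sum_{j=1}^{\infty}\xi_j^*\xi_j$ converges in norm, with coordinatewise operations, inner product $\langle x,y\rangle=\sum_{j=1}^{\infty}\xi_j^*\eta_j$ (for $y=(\eta_1,\eta_2,\dots)$) and norm $\|x\|=\|\langle x,x\rangle\|^{1/2}$. The topology $\tau$ on $l^2(\mathcal A)$ is the locally convex topology generated by all seminorms $p_{\varphi,y}(x)=\sqrt{\sum_{j=1}^{\infty}|\varphi(\eta_j^*\xi_j)|^2}$, $x=(\xi_1,\xi_2,\dots)$, where $\varphi$ is a normal state on $\mathcal A$ and $y=(\eta_1,\eta_2,\dots)$ is any sequence in $\mathcal A$ with $\sup_{j\ge1}\varphi(\eta_j^*\eta_j)=1$. A set $S\subseteq l^2(\mathcal A)$ is totally bounded in $\tau$ if for every such seminorm $p=p_{\varphi,y}$ and every $\varepsilon>0$ there are finitely many points $c_1,\dots,c_m\in l^2(\mathcal A)$ such that the sets $\{x : p(c_i-x)<\varepsilon\}$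 cover $S$. $B^a(l^2(\mathcal A))$ denotes the algebra of all bounded $\mathcal A$-linear operators on $l^2(\mathcal A)$ having an adjoint with respect to $\langle\cdot,\cdot\rangle$; the "compact" operators belong to it. *)

theory Defs
  imports "HOL-Analysis.Analysis"
begin

section \<open>Complex Banach spaces and unital W*-algebras\<close>

class complex_normed_space = real_normed_vector +
  fixes scaleC :: "complex \<Rightarrow> 'a \<Rightarrow> 'a"  (infixr "*\<^sub>C" 75)
  assumes scaleC_add_right: "c *\<^sub>C (x + y) = c *\<^sub>C x + c *\<^sub>C y"
    and scaleC_add_left: "(c + d) *\<^sub>C x = c *\<^sub>C x + d *\<^sub>C x"
    and scaleC_scaleC: "c *\<^sub>C d *\<^sub>C x = (c * d) *\<^sub>C x"
    and scaleR_scaleC: "r *\<^sub>R x = complex_of_real r *\<^sub>C x"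
    and norm_scaleC: "norm (c *\<^sub>C x) = cmod c * norm x"

class complex_banach = complex_normed_space + banach

text \<open>A unital C*-algebra. As usual for unital Banach algebras the unit has norm 1
  (part of \<^class>\<open>real_normed_algebra_1\<close>), which only excludes the zero algebra.\<close>

class cstar_algebra = complex_banach + real_normed_algebra_1 +
  fixes star :: "'a \<Rightarrow> 'a"
  assumes scaleC_mult_left: "(c *\<^sub>C x) * y = c *\<^sub>C (x * y)"
    and scaleC_mult_right: "x * (c *\<^sub>C y) = c *\<^sub>C (x * y)"
    and star_add: "star (x + y) = star x + star y"
    and star_scaleC: "star (c *\<^sub>C x) = cnj c *\<^sub>C star x"
    and star_mult: "star (x * y) = star y * star x"
    and star_star: "star (star x) = x"
    and cstar_identity: "norm (star x * x) = (norm x)\<^sup>2"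

definition dual_space :: "('p::complex_normed_space \<Rightarrow> complex) set" where
  "dual_space = {f. bounded_linear f \<and> (\<forall>c x. f (c *\<^sub>C x) = c * f x)}"

text \<open>A C*-algebra is a W*-algebra iff it is, as a Banach space, isometrically isomorphic to the
  dual of some complex Banach space, its predual. The predual is the type \<open>'p\<close> and
  \<open>J\<close> is the isometric isomorphism; \<^const>\<open>onorm\<close> is the norm of the dual space.\<close>

definition wstar_algebra_via :: "('a::cstar_algebra \<Rightarrow> 'p::complex_banach \<Rightarrow> complex) \<Rightarrow> bool" where
  "wstar_algebra_via J \<longleftrightarrow>
     bij_betw J UNIV dual_space \<and>
     (\<forall>a b. J (a + b) = (\<lambda>p. J a p + J b p)) \<and>
     (\<forall>c a. J (c *\<^sub>C a) = (\<lambda>p. c * J a p)) \<and>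
     (\<forall>a. onorm (J a) = norm a)"


section \<open>Normal states\<close>

definition cstar_positive :: "'a::cstar_algebra \<Rightarrow> bool" where
  "cstar_positive a \<longleftrightarrow> (\<exists>b. a = star b * b)"

definition cstar_le :: "'a::cstar_algebra \<Rightarrow> 'a \<Rightarrow> bool" where
  "cstar_le a b \<longleftrightarrow> cstar_positive (b - a)"

definition is_state :: "('a::cstar_algebra \<Rightarrow> complex) \<Rightarrow> bool" where
  "is_state \<phi> \<longleftrightarrow>
     \<phi> \<in> dual_space \<and> (\<forall>a. cstar_positive a \<longrightarrow> \<phi> a \<in> \<real>\<^sub>\<ge>\<^sub>0) \<and> onorm \<phi> = 1"

definition increasing_to :: "'a::cstar_algebra set \<Rightarrow> 'a \<Rightarrow> bool" where
  "increasing_to D s \<longleftrightarrow>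
     D \<noteq> {} \<and> (\<forall>a\<in>D. star a = a) \<and> star s = s \<and>
     (\<forall>a\<in>D. \<forall>b\<in>D. \<exists>c\<in>D. cstar_le a c \<and> cstar_le b c) \<and>
     (\<forall>a\<in>D. cstar_le a s) \<and>
     (\<forall>u. star u = u \<longrightarrow> (\<forall>a\<in>D. cstar_le a u) \<longrightarrow> cstar_le s u)"

text \<open>Normality: a state preserves suprema of increasing nets of self-adjoint elements that are
  bounded above. The net is given as an upward directed set \<open>D\<close> with supremum \<open>s\<close>; states are real
  on self-adjoint elements and monotone, so the real supremum below is that of a nonempty set
  bounded above.\<close>

definition is_normal_state :: "('a::cstar_algebra \<Rightarrow> complex) \<Rightarrow> bool" where
  "is_normal_state \<phi> \<longleftrightarrow>
     is_state \<phi> \<and> (\<forall>D s. increasing_to D s \<longrightarrow> Re (\<phi> s) = (SUP a\<in>D. Re (\<phi> a)))"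


section \<open>The standard Hilbert module\<close>

text \<open>Sequences are indexed from 0. Elements of the module are functions lying in the set \<open>l2\<close>,
  and an operator is a function on sequences of which only the restriction to \<open>l2\<close> matters.\<close>

definition l2 :: "(nat \<Rightarrow> 'a::cstar_algebra) set" where
  "l2 = {x. summable (\<lambda>j. star (x j) * x j)}"

definition l2_inner :: "(nat \<Rightarrow> 'a::cstar_algebra) \<Rightarrow> (nat \<Rightarrow> 'a) \<Rightarrow> 'a" where
  "l2_inner x y = (\<Sum>j. star (x j) * y j)"

definition l2_norm :: "(nat \<Rightarrow> 'a::cstar_algebra) \<Rightarrow> real" where
  "l2_norm x = sqrt (norm (l2_inner x x))"

type_synonym 'a l2_op = "(nat \<Rightarrow> 'a) \<Rightarrow> (nat \<Rightarrow> 'a)"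

definition adjointable_ops :: "'a::cstar_algebra l2_op set" where
  "adjointable_ops = {T.
     (\<forall>x\<in>l2. T x \<in> l2) \<and>
     (\<forall>x\<in>l2. \<forall>y\<in>l2. T (\<lambda>j. x j + y j) = (\<lambda>j. T x j + T y j)) \<and>
     (\<forall>x\<in>l2. \<forall>a. T (\<lambda>j. x j * a) = (\<lambda>j. T x j * a)) \<and>
     (\<exists>K. \<forall>x\<in>l2. l2_norm (T x) \<le> K * l2_norm x) \<and>
     (\<exists>T'. (\<forall>y\<in>l2. T' y \<in> l2) \<and> (\<forall>x\<in>l2. \<forall>y\<in>l2. l2_inner (T x) y = l2_inner x (T' y)))}"

text \<open>Only applied to operators that are bounded on the unit ball of \<open>l2\<close>, where the supremum is
  the usual operator norm.\<close>

definition l2_onorm :: "'a::cstar_algebra l2_op \<Rightarrow> real" where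
  "l2_onorm T = (SUP x\<in>{x\<in>l2. l2_norm x \<le> 1}. l2_norm (T x))"

definition Theta :: "(nat \<Rightarrow> 'a::cstar_algebra) \<Rightarrow> (nat \<Rightarrow> 'a) \<Rightarrow> 'a l2_op" where
  "Theta y z = (\<lambda>x j. z j * l2_inner y x)"

definition Theta_span :: "'a::cstar_algebra l2_op set" where
  "Theta_span = {\<lambda>x j. \<Sum>k<n. c k *\<^sub>C Theta (y k) (z k) x j | (n::nat) c y z.
     \<forall>k<n. y k \<in> l2 \<and> z k \<in> l2}"

text \<open>The ``compact'' operators: the operator-norm closure of \<^term>\<open>Theta_span\<close> in the algebra of
  bounded adjointable operators.\<close>

definition quoted_compact_ops :: "'a::cstar_algebra l2_op set" where
  "quoted_compact_ops =
     {T \<in> adjointable_ops. \<forall>\<epsilon>>0. \<exists>S\<in>Theta_span. l2_onorm (\<lambda>x j. T x j - S x j) < \<epsilon>}"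


section \<open>Total boundedness in the topology \<open>\<tau>\<close> and compact operators\<close>

text \<open>The pairs indexing the seminorms generating \<open>\<tau>\<close>. Boundedness is stated separately because a
  real supremum of an unbounded set is unspecified.\<close>

definition tau_index :: "('a::cstar_algebra \<Rightarrow> complex) \<Rightarrow> (nat \<Rightarrow> 'a) \<Rightarrow> bool" where
  "tau_index \<phi> y \<longleftrightarrow>
     is_normal_state \<phi> \<and>
     bdd_above (range (\<lambda>j. Re (\<phi> (star (y j) * y j)))) \<and>
     (SUP j. Re (\<phi> (star (y j) * y j))) = 1"

definition tau_seminorm :: "('a::cstar_algebra \<Rightarrow> complex) \<Rightarrow> (nat \<Rightarrow> 'a) \<Rightarrow> (nat \<Rightarrow> 'a) \<Rightarrow> real" where
  "tau_seminorm \<phi> y x = sqrt (\<Sum>j. (cmod (\<phi> (star (y j) * x j)))\<^sup>2)"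

definition tau_totally_bounded :: "(nat \<Rightarrow> 'a::cstar_algebra) set \<Rightarrow> bool" where
  "tau_totally_bounded S \<longleftrightarrow>
     (\<forall>\<phi> y. tau_index \<phi> y \<longrightarrow> (\<forall>\<epsilon>>0. \<exists>C. finite C \<and> C \<subseteq> l2 \<and>
        S \<subseteq> (\<Union>c\<in>C. {x\<in>l2. tau_seminorm \<phi> y (\<lambda>j. c j - x j) < \<epsilon>})))"

definition l2_norm_bounded :: "(nat \<Rightarrow> 'a::cstar_algebra) set \<Rightarrow> bool" where
  "l2_norm_bounded S \<longleftrightarrow> S \<subseteq> l2 \<and> (\<exists>R. \<forall>x\<in>S. l2_norm x \<le> R)"

definition tau_compact_op :: "'a::cstar_algebra l2_op \<Rightarrow> bool" where
  "tau_compact_op T \<longleftrightarrow> (\<forall>S. l2_norm_bounded S \<longrightarrow> tau_totally_bounded (T ` S))"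

end

theory Submission
  imports Defs
begin

text \<open>
  Each seminorm of \<open>\<tau>\<close> satisfies
  \<open>p(x)\<^sup>2 \<le> \<Sum>\<^sub>j\<^sub><\<^sub>N |\<phi>(\<eta>\<^sub>j\<^sup>*\<xi>\<^sub>j)|\<^sup>2 + \<parallel>P\<^sub>N x\<parallel>\<^sup>2\<close>, where \<open>P\<^sub>N\<close> cuts off the first \<open>N\<close> coordinates, because
  \<open>|\<phi>(\<eta>\<^sub>j\<^sup>*\<xi>\<^sub>j)|\<^sup>2 \<le> \<phi>(\<xi>\<^sub>j\<^sup>*\<xi>\<^sub>j)\<close>. So a norm bounded set with uniformly small tails is totally
  bounded, by total boundedness of bounded sets in \<open>\<complex>\<^sup>N\<close>. On the unit ball, \<open>\<Theta>\<^sub>y\<^sub>,\<^sub>z x = z\<langle>y,x\<rangle>\<close> has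
  uniformly small tails since those of \<open>z\<close> are small and \<open>\<langle>y,x\<rangle>\<close> is bounded, and this passes to sums
  and norm limits.

  That \<open>l\<^sup>2(A)\<close> is closed under addition and that \<open>\<langle>y,x\<rangle>\<close> converges needs \<open>\<parallel>p\<parallel> \<le> \<parallel>p + q\<parallel>\<close> for sums
  of elements \<open>x\<^sup>*x\<close>, hence the Fukamiya--Kaplansky theorem that such elements are positive. This
  follows without spectra or functional calculus from the existence of square roots of strictly
  positive elements, which are obtained from the contraction \<open>y \<mapsto> (x + y\<^sup>2)/2\<close>.
\<close>

section \<open>Positive elements of a C*-algebra\<close>

interpretation scaleC: vector_space "scaleC :: complex \<Rightarrow> 'a::complex_normed_space \<Rightarrow> 'a"
proof
  fix x :: 'a
  show "1 *\<^sub>C x = x"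
    using scaleR_scaleC[of 1 x] by simp
qed (simp_all add: scaleC_add_right scaleC_add_left scaleC_scaleC)

lemma norm_star [simp]: "norm (star x) = norm (x::'a::cstar_algebra)"
proof -
  have le: "norm y \<le> norm (star y)" for y :: 'a
    using cstar_identity[of y] norm_mult_ineq[of "star y" y]
    by (cases "y = 0") (auto simp: power2_eq_square)
  show ?thesis
    using le[of x] le[of "star x"] by (simp add: star_star)
qed

lemma star_scaleR: "star (r *\<^sub>R x) = r *\<^sub>R star (x::'a::cstar_algebra)"
  by (simp add: scaleR_scaleC star_scaleC)

lemma bounded_linear_star: "bounded_linear (star :: 'a::cstar_algebra \<Rightarrow> 'a)"
  by (rule bounded_linear_intro[where K = 1]) (simp_all add: star_add star_scaleR)

lemmas star_zero [simp] = linear_0[OF bounded_linear.linear[OF bounded_linear_star]]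
lemmas star_diff = linear_diff[OF bounded_linear.linear[OF bounded_linear_star]]

lemma star_one [simp]: "star 1 = (1::'a::cstar_algebra)"
  by (metis star_mult star_star mult_1_right)

lemma star_of_real [simp]: "star (of_real r) = (of_real r :: 'a::cstar_algebra)"
  by (simp add: of_real_def star_scaleR)

lemma star_power: "star (x ^ n) = star (x::'a::cstar_algebra) ^ n"
  by (induction n) (simp_all add: star_mult power_commutes)

section \<open>Norms of powers, and square roots near the unit\<close>

lemma norm_selfadjoint_power_two_power:
  fixes k :: "'a::cstar_algebra"
  assumes "star k = k"
  shows "norm (k ^ (2 ^ m)) = norm k ^ (2 ^ m)"
proof (induction m)
  case (Suc m)
  have "norm (k ^ 2 ^ Suc m) = norm (star (k ^ 2 ^ m) * k ^ 2 ^ m)"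
    using assms by (simp add: star_power mult_2 power_add)
  also have "\<dots> = (norm (k ^ 2 ^ m))\<^sup>2"
    by (rule cstar_identity)
  finally show ?case
    using Suc by (simp add: power_mult[symmetric] mult.commute)
qed simp

text \<open>The element y = 1 - sqrt (1 - x) is the fixed point of y -> (x + y^2) / 2, a contraction
  with factor \<open>norm x\<close> on the ball of radius \<open>norm x\<close>. The commutation
  clause is what later allows products of roots to be squared factor by factor.\<close>

lemma sqrt_one_minus:
  fixes x :: "'a::cstar_algebra"
  assumes sa: "star x = x" and x: "norm x < 1"
  shows "\<exists>y. star y = y \<and> norm y \<le> norm x \<and> (1 - y) * (1 - y) = 1 - x \<and>
             (\<forall>z. z * x = x * z \<longrightarrow> z * y = y * z)"
proof -
  \<comment> \<open>All properties wanted of y are closed conditions, so they are built into the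
    domain and the fixed point inherits them.\<close>
  define S where "S = {y. star y = y \<and> norm y \<le> norm x \<and> (\<forall>z. z * x = x * z \<longrightarrow> z * y = y * z)}"
  define f where "f = (\<lambda>y. (1/2) *\<^sub>R (x + y * y))"
  have cont: "continuous_on UNIV (star :: 'a \<Rightarrow> 'a)"
    by (rule linear_continuous_on[OF bounded_linear_star])
  have "closed S"
    unfolding S_def
    by (intro closed_Collect_conj closed_Collect_all closed_Collect_imp closed_Collect_eq
        closed_Collect_le open_Collect_const continuous_intros cont)
  then have compl: "complete S"
    by (simp add: complete_eq_closed)
  have ne: "S \<noteq> {}"
    using sa by (auto simp: S_def intro!: exI[of _ 0])
  have SD: "star y = y" "norm y \<le> norm x" "z * x = x * z \<Longrightarrow> z * y = y * z" if "y \<in> S" for y z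
    using that unfolding S_def by blast+
  have inv: "f ` S \<subseteq> S"
  proof safe
    fix y assume y: "y \<in> S"
    have "norm (y * y) \<le> norm y * norm y"
      by (rule norm_mult_ineq)
    also have "\<dots> \<le> norm x * norm x"
      using SD(2)[OF y] by (intro mult_mono) auto
    also have "\<dots> \<le> norm x * 1"
      using x by (intro mult_left_mono) auto
    finally have "norm (x + y * y) \<le> 2 * norm x"
      using norm_triangle_ineq[of x "y * y"] by simp
    then have "norm (f y) \<le> norm x"
      by (simp add: f_def)
    moreover have "star (f y) = f y"
      using SD(1)[OF y] sa by (simp add: f_def star_scaleR star_add star_mult)
    moreover have "z * f y = f y * z" if "z * x = x * z" for z
    proof -
      have "z * y = y * z"
        by (rule SD(3)[OF y that])
      then have "z * (y * y) = y * y * z"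
        by (metis mult.assoc)
      then show ?thesis
        using that by (simp add: f_def algebra_simps)
    qed
    ultimately show "f y \<in> S"
      unfolding S_def by blast
  qed
  have lip: "dist (f y) (f z) \<le> norm x * dist y z" if "y \<in> S" "z \<in> S" for y z
  proof -
    have "norm (y * y - z * z) = norm (y * (y - z) + (y - z) * z)"
      by (simp add: algebra_simps)
    also have "\<dots> \<le> norm y * norm (y - z) + norm (y - z) * norm z"
      by (intro order_trans[OF norm_triangle_ineq] add_mono norm_mult_ineq)
    also have "\<dots> \<le> norm x * norm (y - z) + norm (y - z) * norm x"
      using that by (intro add_mono mult_mono SD) auto
    finally have "norm (y * y - z * z) \<le> 2 * (norm x * norm (y - z))"
      by simp
    moreover have "f y - f z = (1/2) *\<^sub>R (y * y - z * z)"
      by (simp add: f_def algebra_simps)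
    ultimately show ?thesis
      by (simp add: dist_norm)
  qed
  have "\<exists>!y\<in>S. f y = y"
    by (rule Banach_fix[OF compl ne norm_ge_zero x inv lip])
  then obtain y where y: "y \<in> S" "f y = y"
    by (elim ex1E conjE)
  have "2 *\<^sub>R f y = x + y * y"
    by (simp add: f_def)
  then have "x + y * y = y + y"
    using y(2) by (simp add: scaleR_2)
  then have "(1 - y) * (1 - y) = 1 - x"
    by (simp add: algebra_simps)
  with y(1) show ?thesis
    unfolding S_def by blast
qed

text \<open>Positivity is expressed through the norm, which makes sums of positive elements positive
  at once; the condition says that the spectrum lies in the disc \<open>|z - c| \<le> c\<close>.\<close>

definition pos_elem :: "'a::cstar_algebra \<Rightarrow> bool" where
  "pos_elem h \<longleftrightarrow> star h = h \<and> (\<exists>c. norm (of_real c - h) \<le> c)"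

section \<open>The cone of positive elements\<close>

lemma pos_elem_selfadjoint: "pos_elem h \<Longrightarrow> star h = h"
  by (simp add: pos_elem_def)

lemma pos_elemI: "star h = h \<Longrightarrow> norm (of_real c - h) \<le> c \<Longrightarrow> pos_elem h"
  by (auto simp: pos_elem_def)

lemma pos_elem_add:
  assumes "pos_elem g" "pos_elem h"
  shows "pos_elem (g + h)"
proof -
  obtain c d where cd: "norm (of_real c - g) \<le> c" "norm (of_real d - h) \<le> d"
    using assms by (auto simp: pos_elem_def)
  have "of_real (c + d) - (g + h) = (of_real c - g) + (of_real d - h)"
    by simp
  then have "norm (of_real (c + d) - (g + h)) \<le> c + d"
    using cd norm_triangle_mono by metis
  with assms show ?thesis
    by (intro pos_elemI[of _ "c + d"]) (simp_all add: pos_elem_def star_add)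
qed

lemma pos_elem_scaleR:
  assumes "pos_elem h" "0 \<le> r"
  shows "pos_elem (r *\<^sub>R h)"
proof -
  obtain c where c: "norm (of_real c - h) \<le> c"
    using assms by (auto simp: pos_elem_def)
  have "of_real (r * c) - r *\<^sub>R h = r *\<^sub>R (of_real c - h)"
    by (simp add: scaleR_diff_right of_real_def)
  then have "norm (of_real (r * c) - r *\<^sub>R h) \<le> r * c"
    using c assms(2) by (simp add: mult_left_mono)
  with assms show ?thesis
    by (intro pos_elemI[of _ "r * c"]) (simp_all add: pos_elem_def star_scaleR)
qed

lemma pos_elem_of_real: "0 \<le> r \<Longrightarrow> pos_elem (of_real r)"
  by (auto simp: pos_elem_def intro!: exI[of _ r])

lemma pos_elem_of_real_diff:
  "star h = h \<Longrightarrow> norm h \<le> c \<Longrightarrow> pos_elem (of_real c - h)"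
  by (auto simp: pos_elem_def star_diff intro!: exI[of _ c])

text \<open>Rescaling gives h + d = (c + d) (1 - x) with x = (c - h) / (c + d), and
  \<open>0 < d\<close> makes the norm of x strictly less than 1, as the contraction
  requires.\<close>

lemma pos_elem_sqrt:
  assumes h: "pos_elem h" and d: "0 < d"
  shows "\<exists>s. pos_elem s \<and> s * s = h + of_real d \<and> (\<forall>z. z * h = h * z \<longrightarrow> z * s = s * z)"
proof -
  obtain c where c: "norm (of_real c - h) \<le> c" and sa: "star h = h"
    using h by (auto simp: pos_elem_def)
  have c0: "0 \<le> c"
    using c norm_ge_zero order_trans by blast
  define x where "x = (1 / (c + d)) *\<^sub>R (of_real c - h)"
  have "norm x \<le> c / (c + d)"
    using c c0 d by (simp add: x_def divide_right_mono)
  also have "\<dots> < 1"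
    using c0 d by simp
  finally have "norm x < 1" .
  moreover have "star x = x"
    using sa by (simp add: x_def star_scaleR star_diff)
  ultimately obtain y where y: "star y = y" "norm y \<le> norm x" "(1 - y) * (1 - y) = 1 - x"
      "\<And>z. z * x = x * z \<Longrightarrow> z * y = y * z"
    using sqrt_one_minus[of x] by blast
  define s where "s = sqrt (c + d) *\<^sub>R (1 - y)"
  have "s * s = (c + d) *\<^sub>R (1 - x)"
    using y(3) c0 d by (simp add: s_def)
  also have "\<dots> = of_real (c + d) - (c + d) *\<^sub>R x"
    by (simp add: scaleR_diff_right of_real_def)
  also have "(c + d) *\<^sub>R x = of_real c - h"
    using c0 d by (simp add: x_def)
  also have "of_real (c + d) - (of_real c - h) = h + of_real d"
    by simp
  finally have "s * s = h + of_real d" .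
  moreover have "pos_elem s"
    using pos_elem_of_real_diff[of y 1] y(1,2) \<open>norm x < 1\<close> c0 d
    by (auto simp: s_def intro!: pos_elem_scaleR)
  moreover have "z * s = s * z" if "z * h = h * z" for z
  proof -
    have "z * x = x * z"
      using that by (simp add: x_def of_real_def algebra_simps)
    from y(4)[OF this] show ?thesis
      by (simp add: s_def algebra_simps)
  qed
  ultimately show ?thesis
    by blast
qed

text \<open>Here \<open>h + \<i>k\<close> is a multiple of a unitary.\<close>

lemma norm_le_of_square_sum:
  fixes h k :: "'a::cstar_algebra"
  assumes sa: "star h = h" "star k = k" and comm: "h * k = k * h"
    and sum: "h * h + k * k = of_real (r\<^sup>2)" and r: "0 \<le> r"
  shows "norm h \<le> r" "norm k \<le> r"
proof -
  define u where "u = h + \<i> *\<^sub>C k"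
  have su: "star u = h - \<i> *\<^sub>C k"
    using sa by (simp add: u_def star_add star_scaleC scaleC.scale_minus_left)
  have "star u * u = h * h + k * k"
    unfolding su using comm
    by (simp add: u_def algebra_simps scaleC_mult_left scaleC_mult_right scaleC_scaleC
        scaleC.scale_minus_left)
  then have "(norm u)\<^sup>2 = r\<^sup>2"
    using cstar_identity[of u] sum r by (simp del: of_real_power)
  then have nu: "norm u = r"
    using r by simp
  have "2 *\<^sub>R h = u + star u"
    unfolding su by (simp add: u_def scaleR_2)
  then have "norm (2 *\<^sub>R h) \<le> r + r"
    using norm_triangle_ineq[of u "star u"] nu by simp
  then show "norm h \<le> r"
    by simp
  have "2 *\<^sub>R (\<i> *\<^sub>C k) = u - star u"
    unfolding su by (simp add: u_def scaleR_2)
  then have "norm (2 *\<^sub>R (\<i> *\<^sub>C k)) \<le> r + r"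
    using norm_triangle_ineq4[of u "star u"] nu by simp
  then show "norm k \<le> r"
    by (simp add: norm_scaleC)
qed

text \<open>Roots a, b of c + h + d and c - h + d commute with each other and with h, and h^2 + (a
  b)^2 = (c + d)^2. So h is the real part of a multiple of a unitary.\<close>

lemma norm_le_of_pos_elem:
  fixes h :: "'a::cstar_algebra"
  assumes p: "pos_elem (of_real c + h)" "pos_elem (of_real c - h)" and c: "0 \<le> c"
  shows "norm h \<le> c"
proof (rule field_le_epsilon)
  fix d :: real assume d: "0 < d"
  have sa: "star h = h"
    using pos_elem_selfadjoint[OF p(1)] by (simp add: star_add)
  obtain a where a: "pos_elem a" "a * a = of_real c + h + of_real d"
      "\<And>z. z * (of_real c + h) = (of_real c + h) * z \<Longrightarrow> z * a = a * z"
    using pos_elem_sqrt[OF p(1) d] by blast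
  obtain b where b: "pos_elem b" "b * b = of_real c - h + of_real d"
      "\<And>z. z * (of_real c - h) = (of_real c - h) * z \<Longrightarrow> z * b = b * z"
    using pos_elem_sqrt[OF p(2) d] by blast
  have ha: "h * a = a * h"
    by (rule a(3)) (simp add: algebra_simps of_real_def)
  have hb: "h * b = b * h"
    by (rule b(3)) (simp add: algebra_simps of_real_def)
  have ab: "a * b = b * a"
    by (rule b(3)) (simp add: algebra_simps of_real_def ha)
  have diff_squares: "(of_real r + h) * (of_real r - h) = of_real (r\<^sup>2) - h * h" for r
    by (simp add: algebra_simps of_real_def power2_eq_square)
  have "a * b * (a * b) = (a * a) * (b * b)"
    by (metis ab mult.assoc)
  also have "\<dots> = (of_real (c + d) + h) * (of_real (c + d) - h)"
    by (simp add: a(2) b(2) algebra_simps)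
  also have "\<dots> = of_real ((c + d)\<^sup>2) - h * h"
    by (rule diff_squares)
  finally have "h * h + a * b * (a * b) = of_real ((c + d)\<^sup>2)"
    by simp
  moreover have "star (a * b) = a * b"
    using a(1) b(1) ab by (simp add: star_mult pos_elem_selfadjoint)
  moreover have "h * (a * b) = a * b * h"
    by (metis ha hb mult.assoc)
  ultimately show "norm h \<le> c + d"
    using norm_le_of_square_sum(1)[of h "a * b" "c + d"] sa c d by simp
qed

text \<open>Every c not below the norm of h is a witness for its positivity: c - h lies between -c
  and c in the order, because 2 c - h and h are positive.\<close>

lemma norm_of_real_diff_le:
  assumes "pos_elem h" "norm h \<le> c"
  shows "norm (of_real c - h) \<le> c"
proof (rule norm_le_of_pos_elem)
  have c: "0 \<le> c"
    using assms(2) norm_ge_zero order_trans by blast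
  then show "0 \<le> c" .
  show "pos_elem (of_real c + (of_real c - h))"
    using assms c by (simp add: pos_elem_add pos_elem_of_real pos_elem_of_real_diff pos_elem_selfadjoint)
  show "pos_elem (of_real c - (of_real c - h))"
    using assms by simp
qed

text \<open>Fixing the witness as \<open>norm h\<close> removes the existential quantifier and makes
  positivity visibly a closed condition.\<close>

lemma pos_elem_iff: "pos_elem h \<longleftrightarrow> star h = h \<and> norm (of_real (norm h) - h) \<le> norm h"
  using norm_of_real_diff_le[of h "norm h"] by (auto simp: pos_elem_def)

section \<open>Limits in the cone and monotonicity of the norm\<close>

lemma closed_pos_elem: "closed {h :: 'a::cstar_algebra. pos_elem h}"
  unfolding pos_elem_iff
  by (intro closed_Collect_conj closed_Collect_eq closed_Collect_le continuous_intros
      linear_continuous_on[OF bounded_linear_star])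

lemma pos_elem_lim:
  assumes "\<And>n. pos_elem (f n)" "f \<longlonglongrightarrow> h"
  shows "pos_elem h"
  using closed_sequentially[OF closed_pos_elem, of f h] assms by simp

lemma pos_elem_add_epsilon:
  assumes "\<And>e. 0 < e \<Longrightarrow> pos_elem (h + of_real e)"
  shows "pos_elem h"
proof (rule pos_elem_lim)
  show "pos_elem (h + of_real (1 / real (Suc n)))" for n
    by (rule assms) simp
  have "(\<lambda>n. h + of_real (1 / real (Suc n))) \<longlonglongrightarrow> h + of_real 0"
    by (intro tendsto_intros LIMSEQ_Suc lim_1_over_n)
  then show "(\<lambda>n. h + of_real (1 / real (Suc n))) \<longlonglongrightarrow> h"
    by simp
qed

text \<open>In the order of the cone, -norm (p + q) <= p <= p + q <= norm (p + q).\<close>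

lemma norm_le_norm_add:
  assumes p: "pos_elem p" and q: "pos_elem q"
  shows "norm p \<le> norm (p + q)"
proof (rule norm_le_of_pos_elem)
  show "pos_elem (of_real (norm (p + q)) + p)"
    by (intro pos_elem_add pos_elem_of_real p) simp
  have "pos_elem ((of_real (norm (p + q)) - (p + q)) + q)"
    using p q by (intro pos_elem_add pos_elem_of_real_diff)
      (simp_all add: star_add pos_elem_selfadjoint)
  then show "pos_elem (of_real (norm (p + q)) - p)"
    by simp
qed simp

text \<open>Take k with h^2 + k^2 = r^2. Then \<open>norm k\<close> is at most r, so r^2 - h^2 = k^2
  has norm at most r^2, and r^2 is a witness for the positivity of h^2.\<close>

lemma pos_elem_square:
  assumes sa: "star h = h"
  shows "pos_elem (h * h)"
proof -
  \<comment> \<open>Strictly above \<open>norm h\<close>, so that r^2 - h^2 exceeds a positive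
    element by a positive scalar and has a root.\<close>
  define r where "r = norm h + 1"
  have "0 < r"
    using norm_ge_zero[of h] by (simp add: r_def del: norm_ge_zero)
  have "norm (h * h) \<le> (norm h)\<^sup>2"
    using norm_mult_ineq[of h h] by (simp add: power2_eq_square)
  then have "pos_elem (of_real ((norm h)\<^sup>2) - h * h)"
    using sa by (intro pos_elem_of_real_diff) (simp_all add: star_mult)
  moreover have "r\<^sup>2 - (norm h)\<^sup>2 > 0"
    using norm_ge_zero[of h] by (simp add: r_def power2_eq_square algebra_simps del: norm_ge_zero)
  ultimately obtain k where k: "pos_elem k"
      "k * k = of_real ((norm h)\<^sup>2) - h * h + of_real (r\<^sup>2 - (norm h)\<^sup>2)"
      "\<And>z. z * (of_real ((norm h)\<^sup>2) - h * h) = (of_real ((norm h)\<^sup>2) - h * h) * z \<Longrightarrow> z * k = k * z"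
    using pos_elem_sqrt by blast
  have kk: "h * h + k * k = of_real (r\<^sup>2)"
    using k(2) by simp
  have "h * k = k * h"
    by (rule k(3)) (simp add: algebra_simps of_real_def del: of_real_power)
  then have "norm k \<le> r"
    using norm_le_of_square_sum(2)[OF sa pos_elem_selfadjoint[OF k(1)] _ kk] \<open>0 < r\<close> by simp
  then have "norm (k * k) \<le> r\<^sup>2"
    using norm_mult_ineq[of k k] mult_mono[of "norm k" r "norm k" r] \<open>0 < r\<close>
    by (simp add: power2_eq_square)
  then have "norm (of_real (r\<^sup>2) - h * h) \<le> r\<^sup>2"
    using kk by (metis add_diff_cancel_left')
  then show ?thesis
    using sa by (intro pos_elemI[of _ "r\<^sup>2"]) (simp_all add: star_mult)
qed

text \<open>If l were a root of k commuting with v, then v k v would be the square of the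
  self-adjoint v l. Here l is a root of k + d, and the extra term d v^2 is absorbed in e.\<close>

lemma pos_elem_conj:
  assumes k: "pos_elem k" and v: "star v = v" and comm: "v * k = k * v"
  shows "pos_elem (v * k * v)"
proof -
  have "pos_elem (v * k * v + of_real e)" if e: "0 < e" for e
  proof -
    \<comment> \<open>Chosen so that d v^2 has norm at most e; the added 1 covers v = 0.\<close>
    define d where "d = e / ((norm v)\<^sup>2 + 1)"
    have vp: "0 < (norm v)\<^sup>2 + 1"
      by (simp add: add_nonneg_pos)
    then have d: "0 < d"
      using e by (simp add: d_def)
    obtain l where l: "pos_elem l" "l * l = k + of_real d" "\<And>z. z * k = k * z \<Longrightarrow> z * l = l * z"
      using pos_elem_sqrt[OF k d] by blast
    have vl: "v * l = l * v"
      using l(3) comm by blast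
    have "pos_elem (v * l * (v * l))"
      by (rule pos_elem_square) (simp add: star_mult v pos_elem_selfadjoint[OF l(1)] vl)
    moreover have "v * l * (v * l) = v * (l * l) * v"
      by (metis vl mult.assoc)
    moreover have "v * (l * l) * v = v * k * v + d *\<^sub>R (v * v)"
      by (simp add: l(2) algebra_simps of_real_def)
    moreover have "pos_elem (of_real e - d *\<^sub>R (v * v))"
    proof (rule pos_elem_of_real_diff)
      show "star (d *\<^sub>R (v * v)) = d *\<^sub>R (v * v)"
        by (simp add: star_scaleR star_mult v)
      have "norm (v * v) \<le> (norm v)\<^sup>2 + 1"
        using norm_mult_ineq[of v v] by (simp add: power2_eq_square)
      then have "d * norm (v * v) \<le> d * ((norm v)\<^sup>2 + 1)"
        using d by (intro mult_left_mono) auto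
      also have "\<dots> = e"
        using vp by (simp add: d_def)
      finally show "norm (d *\<^sub>R (v * v)) \<le> e"
        using d by simp
    qed
    ultimately show ?thesis
      using pos_elem_add[of "v * k * v + d *\<^sub>R (v * v)" "of_real e - d *\<^sub>R (v * v)"] by simp
  qed
  then show ?thesis
    by (rule pos_elem_add_epsilon)
qed

text \<open>Geometric growth beats linear growth. The exponents are powers of two because for these
  the norm of a power of a self-adjoint element is known.\<close>

lemma power_le_linear_imp_le_1:
  fixes r M :: real
  assumes r: "0 \<le> r" and le: "\<And>m. r ^ (2 ^ m) \<le> 1 + real (2 ^ m) * M"
  shows "r \<le> 1"
proof (rule ccontr)
  assume "\<not> r \<le> 1"
  then have r1: "1 < r" by simp
  have lim1: "(\<lambda>n. real n * (1 / r) ^ n) \<longlonglongrightarrow> 0"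
    by (rule powser_times_n_limit_0) (use r1 in auto)
  have lim0: "(\<lambda>n. (1 / r) ^ n) \<longlonglongrightarrow> 0"
    by (rule LIMSEQ_power_zero) (use r1 in auto)
  have "(\<lambda>n. (1 / r) ^ n + M * (real n * (1 / r) ^ n)) \<longlonglongrightarrow> 0 + M * 0"
    by (rule tendsto_add[OF lim0 tendsto_mult[OF tendsto_const lim1]])
  moreover have "filterlim (\<lambda>m. 2 ^ m :: nat) at_top sequentially"
    by (intro filterlim_subseq strict_monoI) simp
  ultimately have "(\<lambda>m. (1 / r) ^ (2 ^ m) + M * (real (2 ^ m) * (1 / r) ^ (2 ^ m))) \<longlonglongrightarrow> 0 + M * 0"
    by (rule filterlim_compose)
  moreover have "1 \<le> (1 / r) ^ (2 ^ m) + M * (real (2 ^ m) * (1 / r) ^ (2 ^ m))" for m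
    using le[of m] r1 by (simp add: power_divide field_simps)
  ultimately have "1 \<le> 0 + M * (0::real)"
    by (intro LIMSEQ_le_const) auto
  then show False by simp
qed

text \<open>Since \<open>t (a - t\<^sup>*t) = (a - tt\<^sup>*) t\<close>, the powers of \<open>a - t\<^sup>*t\<close> grow faster than those of
  \<open>a - tt\<^sup>*\<close> by at most a linear factor; for self-adjoint elements this bounds the norm.\<close>

lemma pos_elem_swap:
  fixes t :: "'a::cstar_algebra"
  assumes p: "pos_elem (t * star t + of_real e)" and e: "0 \<le> e"
  shows "pos_elem (star t * t + of_real e)"
proof -
  \<comment> \<open>The first summand makes \<open>norm_of_real_diff_le\<close> applicable; the
    others ensure \<open>e <= c\<close> and \<open>0 < c\<close>.\<close>
  define c where "c = norm (t * star t + of_real e) + e + 1"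
  have c: "0 < c" "e \<le> c"
    using e by (simp_all add: c_def add_nonneg_pos)
  define k where "k = of_real (c - e) - star t * t"
  define k' where "k' = of_real (c - e) - t * star t"
  have "norm (of_real c - (t * star t + of_real e)) \<le> c"
    by (rule norm_of_real_diff_le[OF p]) (use e in \<open>simp add: c_def\<close>)
  then have k': "norm k' \<le> c"
    by (simp add: k'_def algebra_simps)
  have tk: "t * k ^ n = k' ^ n * t" for n
  proof (induction n)
    case (Suc n)
    have "t * k = k' * t"
      by (simp add: k_def k'_def algebra_simps of_real_def)
    then have "t * k ^ Suc n = k' * (t * k ^ n)"
      by (simp flip: mult.assoc)
    then show ?case
      by (simp add: Suc mult.assoc)
  qed simp
  define M where "M = (norm t)\<^sup>2 / c"
  have pow: "norm (k ^ n) \<le> c ^ n * (1 + real n * M)" for n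
  proof (induction n)
    case (Suc n)
    have "norm (star t * (k' ^ n * t)) \<le> norm (star t) * (norm (k' ^ n) * norm t)"
      by (meson norm_mult_ineq order_trans mult_left_mono norm_ge_zero)
    also have "\<dots> \<le> norm (star t) * (c ^ n * norm t)"
      using k' norm_power_ineq[of k' n] power_mono[OF k', of n]
      by (intro mult_left_mono mult_right_mono) auto
    finally have b: "norm (star t * (k' ^ n * t)) \<le> c ^ n * (c * M)"
      using c by (simp add: M_def power2_eq_square mult_ac)
    \<comment> \<open>After t is moved through the power by \<open>tk\<close>, the second term
      involves \<open>k'\<close> only, whose powers are bounded by those of c. Each step thus adds
      at most \<open>c ^ Suc n * M\<close>, whence the linear factor.\<close>
    have "k ^ Suc n = (c - e) *\<^sub>R k ^ n - star t * (t * k ^ n)"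
      by (simp add: k_def of_real_def algebra_simps)
    then have "norm (k ^ Suc n) \<le> (c - e) * norm (k ^ n) + norm (star t * (k' ^ n * t))"
      using norm_triangle_ineq4[of "(c - e) *\<^sub>R k ^ n" "star t * (t * k ^ n)"] c by (simp add: tk)
    also have "\<dots> \<le> c * (c ^ n * (1 + real n * M)) + c ^ n * (c * M)"
      using Suc b c e by (intro add_mono mult_mono) auto
    finally show ?case
      by (simp add: algebra_simps)
  qed simp
  have sa: "star k = k"
    by (simp add: k_def star_diff star_mult star_star)
  have "norm k / c \<le> 1"
  proof (rule power_le_linear_imp_le_1)
    show "(norm k / c) ^ 2 ^ m \<le> 1 + real (2 ^ m) * M" for m
      using pow[of "2 ^ m"] norm_selfadjoint_power_two_power[OF sa, of m] c
      by (simp add: power_divide field_simps)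
  qed (use c in simp)
  then have "norm (of_real c - (star t * t + of_real e)) \<le> c"
    using c by (simp add: k_def algebra_simps)
  then show ?thesis
    by (intro pos_elemI[of _ c]) (simp_all add: star_add star_mult star_star)
qed

text \<open>This is half the sum of the squares of the self-adjoint elements t + star t and i (t -
  star t).\<close>

lemma pos_elem_mult_star_add: "pos_elem (t * star t + star t * t)"
proof -
  define b where "b = \<i> *\<^sub>C (t - star t)"
  have "star b = b"
    by (simp add: b_def star_scaleC star_diff star_star scaleC.scale_right_diff_distrib
        scaleC.scale_minus_left)
  moreover have "star (t + star t) = t + star t"
    by (simp add: star_add star_star)
  ultimately have "pos_elem ((1/2) *\<^sub>R ((t + star t) * (t + star t) + b * b))"
    by (intro pos_elem_scaleR pos_elem_add pos_elem_square) auto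
  moreover have "b * b = - ((t - star t) * (t - star t))"
    by (simp add: b_def scaleC_mult_left scaleC_mult_right scaleC_scaleC scaleC.scale_minus_left)
  moreover have "(t + star t) * (t + star t) - (t - star t) * (t - star t)
      = 2 *\<^sub>R (t * star t + star t * t)"
    by (simp add: algebra_simps scaleR_2)
  ultimately show ?thesis
    by simp
qed

text \<open>The Fukamiya--Kaplansky theorem. Up to \<open>d\<close>, \<open>k\<close> is the absolute value of \<open>h\<close> and
  \<open>v\<close> is twice its negative part.\<close>

theorem pos_elem_star_mult: "pos_elem (star x * x)" for x :: "'a::cstar_algebra"
proof (rule pos_elem_add_epsilon)
  fix e :: real assume e: "0 < e"
  define h where "h = star x * x"
  have sah: "star h = h"
    by (simp add: h_def star_mult star_star)
  \<comment> \<open>The 5 matches the constant in the estimate of v^3 below, so that 5 d =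
    e^2.\<close>
  define d where "d = e\<^sup>2 / 5"
  have d: "0 < d"
    using e by (simp add: d_def)
  obtain k where k: "pos_elem k" "k * k = h * h + of_real d"
      "\<And>z. z * (h * h) = h * h * z \<Longrightarrow> z * k = k * z"
    using pos_elem_sqrt[OF pos_elem_square[OF sah] d] by blast
  have hk: "h * k = k * h"
    by (rule k(3)) (simp add: mult.assoc)
  define v where "v = k - h"
  have sav: "star v = v"
    by (simp add: v_def star_diff sah pos_elem_selfadjoint[OF k(1)])
  have vk: "v * k = k * v"
    by (simp add: v_def algebra_simps hk)
  define q where "q = v * k * v"
  have q: "pos_elem q"
    unfolding q_def by (rule pos_elem_conj[OF k(1) sav vk])
  have vv: "v * v = 2 *\<^sub>R (k * v) - of_real d"
    using k(2) by (simp add: v_def algebra_simps hk scaleR_2)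
  have vvv: "v * v * v = 2 *\<^sub>R q - d *\<^sub>R v"
    unfolding vv by (simp add: q_def algebra_simps vk of_real_def)
  \<comment> \<open>With d = 0 the element \<open>star t * t\<close> would be -q, hence negative.
    Swapping the factors shows that it is also nearly positive, so q and then v are small.\<close>
  define t where "t = x * v"
  have "star t * t = v * h * v"
    by (simp add: t_def star_mult sav h_def mult.assoc)
  also have "\<dots> = q - v * v * v"
    by (simp add: q_def v_def algebra_simps)
  also have "\<dots> = d *\<^sub>R v - q"
    unfolding vvv by (simp add: scaleR_2)
  finally have tt: "star t * t = d *\<^sub>R v - q" .
  have nv: "pos_elem (d *\<^sub>R (of_real (norm v) - v))"
    using d by (intro pos_elem_scaleR pos_elem_of_real_diff sav) auto
  \<comment> \<open>Here \<open>star t * t\<close> cancels against q and d v, which leaves a lower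
    bound for \<open>t * star t\<close> alone.\<close>
  have "pos_elem (t * star t + star t * t + q + d *\<^sub>R (of_real (norm v) - v))"
    by (intro pos_elem_add pos_elem_mult_star_add q nv)
  then have "pos_elem (t * star t + of_real (d * norm v))"
    unfolding tt by (simp add: algebra_simps of_real_def)
  then have "pos_elem (star t * t + of_real (d * norm v))"
    using d by (intro pos_elem_swap) auto
  from pos_elem_add[OF this nv] have "pos_elem (of_real (2 * d * norm v) - q)"
    unfolding tt by (simp add: algebra_simps of_real_def scaleR_2[symmetric])
  moreover have "pos_elem (of_real (2 * d * norm v) + q)"
    using d by (intro pos_elem_add pos_elem_of_real q) auto
  ultimately have nq: "norm q \<le> 2 * d * norm v"
    using d by (intro norm_le_of_pos_elem) auto
  have "norm (v * v * v) \<le> 2 * norm q + d * norm v"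
    unfolding vvv using norm_triangle_ineq4[of "2 *\<^sub>R q" "d *\<^sub>R v"] d by simp
  then have n3: "norm (v * v * v) \<le> 5 * d * norm v"
    using nq by simp
  \<comment> \<open>The fourth power of \<open>norm v\<close> is the norm of v^4, so a bound on v^3
    that is linear in \<open>norm v\<close> limits \<open>norm v\<close> itself.\<close>
  have "(norm v)\<^sup>2 * (norm v)\<^sup>2 = norm (v ^ 4)"
    using norm_selfadjoint_power_two_power[OF sav, of 2] by (simp flip: power_add)
  also have "\<dots> = norm (v * v * v * v)"
    by (simp add: numeral_eq_Suc mult.assoc)
  also have "\<dots> \<le> norm (v * v * v) * norm v"
    by (rule norm_mult_ineq)
  also have "\<dots> \<le> 5 * d * norm v * norm v"
    by (rule mult_right_mono[OF n3]) simp
  also have "\<dots> = e\<^sup>2 * (norm v)\<^sup>2"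
    by (simp add: d_def power2_eq_square)
  finally have le: "(norm v)\<^sup>2 * (norm v)\<^sup>2 \<le> e\<^sup>2 * (norm v)\<^sup>2" .
  have "norm v \<le> e"
  proof (cases "v = 0")
    case False
    then have "(norm v)\<^sup>2 \<le> e\<^sup>2"
      by (intro mult_right_le_imp_le[OF le]) simp
    then show ?thesis
      using e by (simp add: power2_le_iff_abs_le)
  qed (use e in simp)
  \<comment> \<open>This element is h + e, since v = k - h.\<close>
  then have "pos_elem (k + (of_real e - v))"
    by (intro pos_elem_add pos_elem_of_real_diff k sav)
  then show "pos_elem (star x * x + of_real e)"
    by (simp add: v_def h_def algebra_simps)
qed

section \<open>Series of positive elements\<close>

lemma pos_elem_zero [simp]: "pos_elem 0"
  using pos_elem_of_real[of 0] by simp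

lemma pos_elem_sum: "(\<And>i. i \<in> I \<Longrightarrow> pos_elem (f i)) \<Longrightarrow> pos_elem (sum f I)"
  by (induction I rule: infinite_finite_induct) (auto intro: pos_elem_add)

text \<open>Monotonicity of the norm on the cone transfers the Cauchy criterion from blocks of g to
  blocks of f.\<close>

lemma pos_elem_comparison:
  fixes f g :: "nat \<Rightarrow> 'a::cstar_algebra"
  assumes g: "summable g" and f: "\<And>n. pos_elem (f n)" and le: "\<And>n. pos_elem (g n - f n)"
  shows "summable f" "norm (suminf f) \<le> norm (suminf g)"
proof -
  have part: "norm (sum f I) \<le> norm (sum g I)" for I
    using norm_le_norm_add[OF pos_elem_sum pos_elem_sum, of I f I "\<lambda>i. g i - f i"] f le
    by (simp add: sum_subtractf)
  show "summable f"
    unfolding summable_Cauchy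
  proof (intro allI impI)
    fix e :: real assume "0 < e"
    then obtain N where "\<forall>m\<ge>N. \<forall>n. norm (sum g {m..<n}) < e"
      using g unfolding summable_Cauchy by blast
    then show "\<exists>N. \<forall>m\<ge>N. \<forall>n. norm (sum f {m..<n}) < e"
      using part le_less_trans by blast
  qed
  then show "norm (suminf f) \<le> norm (suminf g)"
    by (intro LIMSEQ_le[OF tendsto_norm[OF summable_LIMSEQ] tendsto_norm[OF summable_LIMSEQ]] g)
      (use part in blast)+
qed

section \<open>The standard Hilbert module\<close>

text \<open>Squares are the convenient scale: for them the parallelogram law yields bounds of the
  form 2 a + 2 b directly.\<close>

definition l2_sqnorm :: "(nat \<Rightarrow> 'a::cstar_algebra) \<Rightarrow> real" where
  "l2_sqnorm x = norm (l2_inner x x)"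

lemma l2_norm_eq_sqrt: "l2_norm x = sqrt (l2_sqnorm x)"
  by (simp add: l2_norm_def l2_sqnorm_def)

lemma l2_sqnorm_nonneg: "0 \<le> l2_sqnorm x"
  by (simp add: l2_sqnorm_def)

lemma l2_sqnorm_eq: "l2_sqnorm x = (l2_norm x)\<^sup>2"
  by (simp add: l2_norm_eq_sqrt l2_sqnorm_nonneg)

text \<open>Arranged as a difference that is visibly of the form \<open>star z * z\<close>, hence
  positive, for use in termwise comparison.\<close>

lemma parallelogram:
  fixes x y :: "'a::cstar_algebra"
  shows "2 *\<^sub>R (star x * x + star y * y) - star (x + y) * (x + y) = star (x - y) * (x - y)"
  by (simp add: star_add star_diff algebra_simps scaleR_2)

lemma l2_add:
  assumes x: "x \<in> l2" and y: "y \<in> l2"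
  shows "(\<lambda>j. x j + y j) \<in> l2"
    and "l2_sqnorm (\<lambda>j. x j + y j) \<le> 2 * l2_sqnorm x + 2 * l2_sqnorm y"
proof -
  define g where "g = (\<lambda>j. 2 *\<^sub>R (star (x j) * x j + star (y j) * y j))"
  have xy: "summable (\<lambda>j. star (x j) * x j)" "summable (\<lambda>j. star (y j) * y j)"
    using x y by (simp_all add: l2_def)
  have g: "g sums (2 *\<^sub>R (l2_inner x x + l2_inner y y))"
    unfolding g_def l2_inner_def by (intro sums_scaleR_right sums_add summable_sums xy)
  have le: "pos_elem (g j - star (x j + y j) * (x j + y j))" for j
    unfolding g_def parallelogram by (rule pos_elem_star_mult)
  show "(\<lambda>j. x j + y j) \<in> l2"
    using pos_elem_comparison(1)[OF sums_summable[OF g] pos_elem_star_mult le] by (simp add: l2_def)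
  have "l2_sqnorm (\<lambda>j. x j + y j) \<le> norm (suminf g)"
    using pos_elem_comparison(2)[OF sums_summable[OF g] pos_elem_star_mult le]
    by (simp add: l2_sqnorm_def l2_inner_def)
  also have "\<dots> \<le> 2 * (l2_sqnorm x + l2_sqnorm y)"
    unfolding sums_unique[OF g, symmetric]
    using norm_triangle_ineq[of "l2_inner x x" "l2_inner y y"] by (simp add: l2_sqnorm_def)
  finally show "l2_sqnorm (\<lambda>j. x j + y j) \<le> 2 * l2_sqnorm x + 2 * l2_sqnorm y"
    by simp
qed

lemma l2_mult_right:
  assumes x: "x \<in> l2"
  shows "(\<lambda>j. x j * a) \<in> l2"
    and "l2_sqnorm (\<lambda>j. x j * a) \<le> (norm a)\<^sup>2 * l2_sqnorm x"
proof -
  have "summable (\<lambda>j. star (x j) * x j)"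
    using x by (simp add: l2_def)
  then have "(\<lambda>j. star a * (star (x j) * x j) * a) sums (star a * l2_inner x x * a)"
    unfolding l2_inner_def by (intro sums_mult sums_mult2 summable_sums)
  then have s: "(\<lambda>j. star (x j * a) * (x j * a)) sums (star a * l2_inner x x * a)"
    by (simp add: star_mult mult.assoc)
  show "(\<lambda>j. x j * a) \<in> l2"
    using sums_summable[OF s] by (simp add: l2_def)
  have "norm (star a * l2_inner x x * a) \<le> norm (star a) * norm (l2_inner x x) * norm a"
    by (meson norm_mult_ineq order_trans mult_right_mono norm_ge_zero)
  then show "l2_sqnorm (\<lambda>j. x j * a) \<le> (norm a)\<^sup>2 * l2_sqnorm x"
    using sums_unique[OF s] by (simp add: l2_sqnorm_def l2_inner_def power2_eq_square mult_ac)
qed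

lemma l2_scaleC:
  assumes "x \<in> l2"
  shows "(\<lambda>j. c *\<^sub>C x j) \<in> l2"
    and "l2_sqnorm (\<lambda>j. c *\<^sub>C x j) \<le> (cmod c)\<^sup>2 * l2_sqnorm x"
  using l2_mult_right[OF assms, of "c *\<^sub>C 1"]
  by (simp_all add: scaleC_mult_right norm_scaleC)

lemma l2_diff:
  assumes x: "x \<in> l2" and y: "y \<in> l2"
  shows "(\<lambda>j. x j - y j) \<in> l2"
    and "l2_sqnorm (\<lambda>j. x j - y j) \<le> 2 * l2_sqnorm x + 2 * l2_sqnorm y"
  using l2_add[OF x l2_scaleC(1)[OF y, of "-1"]] l2_scaleC(2)[OF y, of "-1"]
  by (simp_all add: scaleC.scale_minus_left)

section \<open>Convergence of inner products\<close>

lemma bounded_linear_scaleC: "bounded_linear (\<lambda>x :: 'a::complex_normed_space. c *\<^sub>C x)"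
  by (rule bounded_linear_intro[where K = "cmod c"])
    (simp_all add: scaleC_add_right scaleR_scaleC scaleC_scaleC norm_scaleC mult.commute)

lemma polarization:
  fixes x y :: "'a::cstar_algebra"
  defines "s \<equiv> \<lambda>c. star (x + c *\<^sub>C y) * (x + c *\<^sub>C y)"
  shows "star y * x = (1/4) *\<^sub>R (s 1 + \<i> *\<^sub>C s \<i> + (-1) *\<^sub>C s (-1) + (-\<i>) *\<^sub>C s (-\<i>))"
proof -
  have s: "s c = star x * x + (c * cnj c) *\<^sub>C (star y * y) + c *\<^sub>C (star x * y) + cnj c *\<^sub>C (star y * x)" for c
    by (simp add: s_def star_add star_scaleC scaleC_mult_left scaleC_mult_right scaleC_scaleC
        scaleC_add_right distrib_left distrib_right add_ac mult_ac)
  have "s 1 + \<i> *\<^sub>C s \<i> + (-1) *\<^sub>C s (-1) + (-\<i>) *\<^sub>C s (-\<i>)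
      = star y * x + star y * x + star y * x + star y * x"
    unfolding s by (simp add: scaleC_add_right scaleC_scaleC scaleC.scale_minus_left
        scaleC.scale_right_diff_distrib algebra_simps)
  also have "\<dots> = (2 + 2) *\<^sub>R (star y * x)"
    by (simp only: scaleR_add_left scaleR_2 add.assoc)
  finally show ?thesis
    by simp
qed

text \<open>Polarization splits the series into four of the form <w, w>, which converge by
  \<open>l2_add\<close>; the factor 1/4 offsets the four equal bounds. For fixed y the result is
  uniform over the unit ball.\<close>

lemma l2_inner_bound:
  assumes x: "x \<in> l2" and y: "y \<in> l2"
  shows "norm (l2_inner y x) \<le> 2 * l2_sqnorm x + 2 * l2_sqnorm y"
proof -
  define w where "w = (\<lambda>c j. x j + c *\<^sub>C y j)"
  define s where "s = (\<lambda>c j. star (w c j) * w c j)"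
  have w: "w c \<in> l2" "cmod c = 1 \<Longrightarrow> l2_sqnorm (w c) \<le> 2 * l2_sqnorm x + 2 * l2_sqnorm y" for c
    using l2_add[OF x l2_scaleC(1)[OF y, of c]] l2_scaleC(2)[OF y, of c] by (simp_all add: w_def)
  have sc: "(\<lambda>j. d *\<^sub>C s c j) sums (d *\<^sub>C l2_inner (w c) (w c))" for c d
    using w(1)[of c] unfolding s_def l2_inner_def l2_def
    by (intro bounded_linear.sums[OF bounded_linear_scaleC] summable_sums) simp
  have pol: "star (y j) * x j
      = (1/4) *\<^sub>R (1 *\<^sub>C s 1 j + \<i> *\<^sub>C s \<i> j + (-1) *\<^sub>C s (-1) j + (-\<i>) *\<^sub>C s (-\<i>) j)" for j
    using polarization[of "y j" "x j"] by (simp add: s_def w_def)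
  let ?I = "\<lambda>c. l2_inner (w c) (w c)"
  have "(\<lambda>j. star (y j) * x j) sums
      ((1/4) *\<^sub>R (1 *\<^sub>C ?I 1 + \<i> *\<^sub>C ?I \<i> + (-1) *\<^sub>C ?I (-1) + (-\<i>) *\<^sub>C ?I (-\<i>)))"
    unfolding pol
    by (rule sums_scaleR_right[OF sums_add[OF sums_add[OF sums_add[OF sc[of 1 1] sc[of \<i> \<i>]]
            sc[of "-1" "-1"]] sc[of "-\<i>" "-\<i>"]]])
  then have "l2_inner y x = (1/4) *\<^sub>R (1 *\<^sub>C ?I 1 + \<i> *\<^sub>C ?I \<i> + (-1) *\<^sub>C ?I (-1) + (-\<i>) *\<^sub>C ?I (-\<i>))"
    by (simp add: l2_inner_def sums_iff)
  moreover have "norm (1 *\<^sub>C ?I 1 + \<i> *\<^sub>C ?I \<i> + (-1) *\<^sub>C ?I (-1) + (-\<i>) *\<^sub>C ?I (-\<i>))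
      \<le> l2_sqnorm (w 1) + l2_sqnorm (w \<i>) + l2_sqnorm (w (-1)) + l2_sqnorm (w (-\<i>))"
    by (intro norm_triangle_mono) (simp_all add: norm_scaleC l2_sqnorm_def)
  moreover have "\<dots> \<le> 4 * (2 * l2_sqnorm x + 2 * l2_sqnorm y)"
    using w(2)[of 1] w(2)[of \<i>] w(2)[of "-1"] w(2)[of "-\<i>"] by simp
  ultimately show ?thesis
    by simp
qed

section \<open>Tails of sequences\<close>

definition l2_tail :: "nat \<Rightarrow> (nat \<Rightarrow> 'a::zero) \<Rightarrow> nat \<Rightarrow> 'a" where
  "l2_tail N x = (\<lambda>j. if j < N then 0 else x j)"

lemma l2_tail_inner_sums:
  assumes "x \<in> l2"
  shows "(\<lambda>j. star (l2_tail N x j) * l2_tail N x j) sums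
    (l2_inner x x - (\<Sum>j<N. star (x j) * x j))"
proof -
  have "summable (\<lambda>j. star (x j) * x j)"
    using assms by (simp add: l2_def)
  then have "(\<lambda>j. star (x j) * x j - (if j \<in> {..<N} then star (x j) * x j else 0)) sums
      (l2_inner x x - (\<Sum>j<N. star (x j) * x j))"
    unfolding l2_inner_def by (intro sums_diff summable_sums sums_If_finite_set) auto
  moreover have "(\<lambda>j. star (x j) * x j - (if j \<in> {..<N} then star (x j) * x j else 0))
      = (\<lambda>j. star (l2_tail N x j) * l2_tail N x j)"
    by (auto simp: l2_tail_def)
  ultimately show ?thesis
    by simp
qed

lemma l2_tail_in_l2: "x \<in> l2 \<Longrightarrow> l2_tail N x \<in> l2"
  using sums_summable[OF l2_tail_inner_sums] by (simp add: l2_def)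

lemma l2_sqnorm_tail_le:
  assumes "x \<in> l2"
  shows "l2_sqnorm (l2_tail N x) \<le> l2_sqnorm x"
  unfolding l2_sqnorm_def l2_inner_def
proof (rule pos_elem_comparison(2))
  show "summable (\<lambda>j. star (x j) * x j)"
    using assms by (simp add: l2_def)
  show "pos_elem (star (x j) * x j - star (l2_tail N x j) * l2_tail N x j)" for j
    using pos_elem_star_mult[of "x j"] by (simp add: l2_tail_def)
qed (rule pos_elem_star_mult)

lemma l2_sqnorm_tail_tendsto:
  assumes "x \<in> l2"
  shows "(\<lambda>N. l2_sqnorm (l2_tail N x)) \<longlonglongrightarrow> 0"
proof -
  have "(\<lambda>N. \<Sum>j<N. star (x j) * x j) \<longlonglongrightarrow> l2_inner x x"
    using assms unfolding l2_inner_def l2_def by (intro summable_LIMSEQ) simp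
  then have "(\<lambda>N. norm (l2_inner x x - (\<Sum>j<N. star (x j) * x j))) \<longlonglongrightarrow> norm (l2_inner x x - l2_inner x x)"
    by (intro tendsto_intros)
  moreover have "l2_sqnorm (l2_tail N x) = norm (l2_inner x x - (\<Sum>j<N. star (x j) * x j))" for N
    using sums_unique[OF l2_tail_inner_sums[OF assms, of N]]
    by (simp add: l2_sqnorm_def l2_inner_def)
  ultimately show ?thesis
    by simp
qed

lemma l2_tail_add: "l2_tail N (\<lambda>j. x j + y j) = (\<lambda>j. l2_tail N x j + l2_tail N (y :: nat \<Rightarrow> 'a::cstar_algebra) j)"
  by (auto simp: l2_tail_def)

lemma l2_tail_diff: "l2_tail N (\<lambda>j. x j - y j) = (\<lambda>j. l2_tail N x j - l2_tail N (y :: nat \<Rightarrow> 'a::cstar_algebra) j)"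
  by (auto simp: l2_tail_def)

lemma l2_tail_mult_right: "l2_tail N (\<lambda>j. x j * a) = (\<lambda>j. l2_tail N x j * (a::'a::cstar_algebra))"
  by (auto simp: l2_tail_def)

lemma l2_norm_le_1_iff: "l2_norm x \<le> 1 \<longleftrightarrow> l2_sqnorm x \<le> 1"
  by (simp add: l2_norm_eq_sqrt)

lemma l2_tail_0 [simp]: "l2_tail 0 x = x"
  by (simp add: l2_tail_def)

section \<open>Uniformly small tails\<close>

text \<open>F x is a sum of terms z_k a_k(x) with coefficients bounded on the unit ball, so the
  tails of the z_k control those of F x. A null sequence b, rather than an N for each error, adds
  well in the induction on the number of terms, and its value at 0 bounds F x itself.\<close>

lemma Theta_span_tail_bound:
  fixes F :: "'a::cstar_algebra l2_op"
  assumes "F \<in> Theta_span"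
  shows "x \<in> l2 \<Longrightarrow> F x \<in> l2"
    and "\<exists>b. b \<longlonglongrightarrow> 0 \<and> (\<forall>N. \<forall>x\<in>l2. l2_norm x \<le> 1 \<longrightarrow> l2_sqnorm (l2_tail N (F x)) \<le> b N)"
proof -
  obtain n :: nat and c :: "nat \<Rightarrow> complex" and y z :: "nat \<Rightarrow> nat \<Rightarrow> 'a"
    where F: "F = (\<lambda>x j. \<Sum>k<n. c k *\<^sub>C Theta (y k) (z k) x j)"
      and yz: "\<forall>k<n. y k \<in> l2 \<and> z k \<in> l2"
    using assms unfolding Theta_span_def by blast
  define a where "a = (\<lambda>k x. c k *\<^sub>C l2_inner (y k) x)"
  define P where "P = (\<lambda>m x j. \<Sum>k<m. z k j * a k x)"
  have FP: "F = P n"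
    by (simp add: F P_def a_def Theta_def scaleC_mult_right)
  define A where "A = (\<lambda>k. (cmod (c k) * (2 + 2 * l2_sqnorm (y k)))\<^sup>2)"
  have a: "(norm (a k x))\<^sup>2 \<le> A k" if "k < n" "x \<in> l2" "l2_norm x \<le> 1" for k x
  proof -
    have "norm (l2_inner (y k) x) \<le> 2 + 2 * l2_sqnorm (y k)"
      using l2_inner_bound[OF that(2), of "y k"] yz that(1,3) by (simp add: l2_norm_le_1_iff)
    then show ?thesis
      by (simp add: A_def a_def norm_scaleC mult_left_mono power_mono)
  qed
  have P_Suc: "P (Suc m) x = (\<lambda>j. P m x j + z m j * a m x)" for m x
    by (simp add: P_def)
  have in_l2: "P m x \<in> l2" if "m \<le> n" for m x
    using that
  proof (induction m)
    case 0
    then show ?case by (simp add: P_def l2_def)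
  next
    case (Suc m)
    then show ?case
      unfolding P_Suc using yz by (intro l2_add(1) l2_mult_right(1)) auto
  qed
  then show "x \<in> l2 \<Longrightarrow> F x \<in> l2"
    by (simp add: FP)
  have "\<exists>b. b \<longlonglongrightarrow> 0 \<and> (\<forall>N. \<forall>x\<in>l2. l2_norm x \<le> 1 \<longrightarrow> l2_sqnorm (l2_tail N (P m x)) \<le> b N)"
    if "m \<le> n" for m
    using that
  proof (induction m)
    case 0
    then show ?case
      by (intro exI[of _ "\<lambda>_. 0"]) (simp add: P_def l2_tail_def l2_sqnorm_def l2_inner_def)
  next
    case (Suc m)
    then obtain b where b: "b \<longlonglongrightarrow> 0"
        "\<And>N x. x \<in> l2 \<Longrightarrow> l2_norm x \<le> 1 \<Longrightarrow> l2_sqnorm (l2_tail N (P m x)) \<le> b N"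
      by auto
    have zm: "z m \<in> l2"
      using yz Suc.prems by simp
    define b' where "b' = (\<lambda>N. 2 * b N + 2 * (A m * l2_sqnorm (l2_tail N (z m))))"
    have "b' \<longlonglongrightarrow> 2 * 0 + 2 * (A m * 0)"
      unfolding b'_def by (intro tendsto_intros b(1) l2_sqnorm_tail_tendsto zm)
    moreover have "l2_sqnorm (l2_tail N (P (Suc m) x)) \<le> b' N" if x: "x \<in> l2" "l2_norm x \<le> 1" for N x
    proof -
      have "l2_sqnorm (l2_tail N (P (Suc m) x))
          \<le> 2 * l2_sqnorm (l2_tail N (P m x)) + 2 * l2_sqnorm (\<lambda>j. l2_tail N (z m) j * a m x)"
        unfolding P_Suc l2_tail_add l2_tail_mult_right
        using Suc.prems by (intro l2_add(2) l2_mult_right(1) l2_tail_in_l2 in_l2 zm) simp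
      also have "l2_sqnorm (\<lambda>j. l2_tail N (z m) j * a m x)
          \<le> (norm (a m x))\<^sup>2 * l2_sqnorm (l2_tail N (z m))"
        by (intro l2_mult_right(2) l2_tail_in_l2 zm)
      also have "\<dots> \<le> A m * l2_sqnorm (l2_tail N (z m))"
        using Suc.prems by (intro mult_right_mono a x l2_sqnorm_nonneg) simp
      finally show ?thesis
        using b(2)[OF x, of N] by (simp add: b'_def)
    qed
    ultimately show ?case
      by (intro exI[of _ b']) simp
  qed
  then show "\<exists>b. b \<longlonglongrightarrow> 0 \<and> (\<forall>N. \<forall>x\<in>l2. l2_norm x \<le> 1 \<longrightarrow> l2_sqnorm (l2_tail N (F x)) \<le> b N)"
    by (simp add: FP)
qed

text \<open>On the unit ball T is uniformly close to some F with uniformly small tails, and cutting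
  off coordinates does not enlarge the error T x - F x.\<close>

lemma quoted_compact_small_tails:
  fixes T :: "'a::cstar_algebra l2_op"
  assumes T: "T \<in> quoted_compact_ops" and e: "0 < e"
  shows "\<exists>N. \<forall>x\<in>l2. l2_norm x \<le> 1 \<longrightarrow> l2_sqnorm (l2_tail N (T x)) \<le> e"
proof -
  have Tl2: "T x \<in> l2" if "x \<in> l2" for x
    using T that by (simp add: quoted_compact_ops_def adjointable_ops_def)
  obtain K where K: "\<And>x. x \<in> l2 \<Longrightarrow> l2_norm (T x) \<le> K * l2_norm x"
    using T unfolding quoted_compact_ops_def adjointable_ops_def by blast
  \<comment> \<open>Two squared errors of at most e / 4, each doubled by \<open>l2_add\<close>, give
    e.\<close>
  define d where "d = sqrt (e / 4)"
  have d: "0 < d" "d\<^sup>2 = e / 4"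
    using e by (simp_all add: d_def)
  obtain F where F: "F \<in> Theta_span" and TF: "l2_onorm (\<lambda>x j. T x j - F x j) < d"
    using T d(1) unfolding quoted_compact_ops_def by blast
  note Fl2 = Theta_span_tail_bound(1)[OF F]
  obtain b where b: "b \<longlonglongrightarrow> 0"
      "\<And>N x. x \<in> l2 \<Longrightarrow> l2_norm x \<le> 1 \<Longrightarrow> l2_sqnorm (l2_tail N (F x)) \<le> b N"
    using Theta_span_tail_bound(2)[OF F] by blast
  \<comment> \<open>\<open>l2_onorm\<close> is a real supremum, so it dominates the values only once
    they are known to be bounded. The term \<open>b 0\<close> bounds F x, as
    \<open>l2_tail 0\<close> is the identity.\<close>
  have bdd: "bdd_above ((\<lambda>x. l2_norm (\<lambda>j. T x j - F x j)) ` {x \<in> l2. l2_norm x \<le> 1})"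
  proof (rule bdd_aboveI2)
    fix x :: "nat \<Rightarrow> 'a" assume "x \<in> {x \<in> l2. l2_norm x \<le> 1}"
    then have x: "x \<in> l2" "l2_norm x \<le> 1" by auto
    have "0 \<le> l2_norm x" "0 \<le> l2_norm (T x)"
      by (simp_all add: l2_norm_def)
    moreover from this have "l2_norm (T x) \<le> \<bar>K\<bar>"
      using K[OF x(1)] x(2) mult_mono[of K "\<bar>K\<bar>" "l2_norm x" 1] abs_ge_self[of K] by linarith
    ultimately have "l2_sqnorm (T x) \<le> K\<^sup>2"
      unfolding l2_sqnorm_eq by (metis power2_abs power_mono)
    then have "l2_sqnorm (\<lambda>j. T x j - F x j) \<le> 2 * K\<^sup>2 + 2 * b 0"
      using l2_diff(2)[OF Tl2 Fl2, OF x(1) x(1)] b(2)[OF x, of 0] by simp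
    then show "l2_norm (\<lambda>j. T x j - F x j) \<le> sqrt (2 * K\<^sup>2 + 2 * b 0)"
      by (simp add: l2_norm_eq_sqrt)
  qed
  have "eventually (\<lambda>N. b N < e / 4) sequentially"
    using order_tendstoD(2)[OF b(1), of "e / 4"] e by simp
  then obtain N where N: "b N < e / 4"
    by (auto simp: eventually_sequentially)
  have "l2_sqnorm (l2_tail N (T x)) \<le> e" if x: "x \<in> l2" "l2_norm x \<le> 1" for x
  proof -
    define u where "u = (\<lambda>j. T x j - F x j)"
    have u: "u \<in> l2"
      unfolding u_def by (intro l2_diff(1) Tl2 Fl2 x)
    have "l2_norm u \<le> l2_onorm (\<lambda>x j. T x j - F x j)"
      unfolding u_def l2_onorm_def by (rule cSUP_upper[OF _ bdd]) (simp add: x)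
    then have "l2_norm u \<le> d"
      using TF by simp
    then have "l2_sqnorm u \<le> e / 4"
      unfolding l2_sqnorm_eq d(2)[symmetric] by (rule power_mono) (simp add: l2_norm_def)
    then have "l2_sqnorm (l2_tail N u) \<le> e / 4"
      using l2_sqnorm_tail_le[OF u, of N] by simp
    moreover have "l2_tail N (T x) = (\<lambda>j. l2_tail N u j + l2_tail N (F x) j)"
      by (simp add: u_def flip: l2_tail_add)
    then have "l2_sqnorm (l2_tail N (T x)) \<le> 2 * l2_sqnorm (l2_tail N u) + 2 * l2_sqnorm (l2_tail N (F x))"
      using l2_add(2)[OF l2_tail_in_l2[OF u] l2_tail_in_l2[OF Fl2[OF x(1)]], of N N] by simp
    ultimately show ?thesis
      using b(2)[OF x, of N] N by simp
  qed
  then show ?thesis by blast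
qed

section \<open>States and the seminorms of \<open>\<tau>\<close>\<close>

lemma state_nonneg:
  assumes "is_state \<phi>"
  shows "Im (\<phi> (star a * a)) = 0" "0 \<le> Re (\<phi> (star a * a))"
proof -
  have "cstar_positive (star a * a)"
    by (auto simp: cstar_positive_def)
  then have "\<phi> (star a * a) \<in> \<real>\<^sub>\<ge>\<^sub>0"
    using assms by (simp add: is_state_def)
  then show "Im (\<phi> (star a * a)) = 0" "0 \<le> Re (\<phi> (star a * a))"
    by (auto simp: complex_nonneg_Reals_iff)
qed

lemma state_linear:
  assumes "is_state \<phi>"
  shows "bounded_linear \<phi>" "\<phi> (c *\<^sub>C a) = c * \<phi> a"
  using assms by (simp_all add: is_state_def dual_space_def)

lemma state_norm_le:
  assumes "is_state \<phi>"
  shows "cmod (\<phi> a) \<le> norm a"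
  using onorm[OF state_linear(1)[OF assms], of a] assms by (simp add: is_state_def)

text \<open>Positivity at x + y makes the imaginary parts of the two values opposite, and positivity
  at x + i y makes their real parts equal.\<close>

lemma state_hermitian:
  assumes st: "is_state \<phi>"
  shows "\<phi> (star x * y) = cnj (\<phi> (star y * x))"
proof -
  interpret \<phi>: bounded_linear \<phi>
    by (rule state_linear(1)[OF st])
  have e: "\<phi> (star (x + c *\<^sub>C y) * (x + c *\<^sub>C y))
      = \<phi> (star x * x) + c * \<phi> (star x * y) + cnj c * \<phi> (star y * x) + c * cnj c * \<phi> (star y * y)" for c
    by (simp add: star_add star_scaleC algebra_simps scaleC_mult_left scaleC_mult_right \<phi>.add
        state_linear(2)[OF st])
  show ?thesis
    using state_nonneg(1)[OF st, of "x + 1 *\<^sub>C y"] state_nonneg(1)[OF st, of "x + \<i> *\<^sub>C y"]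
      state_nonneg(1)[OF st, of x] state_nonneg(1)[OF st, of y]
    unfolding e by (simp add: complex_eq_iff)
qed

text \<open>Evaluating the state at the square of x - g y, with g its value at
  \<open>star y * x\<close>, produces -2 |g|^2 + |g|^2 r, where r is its value at
  \<open>star y * y\<close>; as r is at most 1, this is at most -|g|^2.\<close>

lemma state_Cauchy_Schwarz:
  assumes st: "is_state \<phi>" and y: "Re (\<phi> (star y * y)) \<le> 1"
  shows "(cmod (\<phi> (star y * x)))\<^sup>2 \<le> Re (\<phi> (star x * x))"
proof -
  interpret \<phi>: bounded_linear \<phi>
    by (rule state_linear(1)[OF st])
  define g where "g = \<phi> (star y * x)"
  have "\<phi> (star (x - g *\<^sub>C y) * (x - g *\<^sub>C y))
      = \<phi> (star x * x) - g * \<phi> (star x * y) - cnj g * g + g * cnj g * \<phi> (star y * y)"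
    by (simp add: g_def star_diff star_scaleC algebra_simps scaleC_mult_left scaleC_mult_right
        \<phi>.add \<phi>.diff state_linear(2)[OF st])
  also have "\<phi> (star x * y) = cnj g"
    unfolding g_def by (rule state_hermitian[OF st])
  also have "g * cnj g = complex_of_real ((cmod g)\<^sup>2)"
    by (rule complex_norm_square[symmetric])
  also have "cnj g * g = complex_of_real ((cmod g)\<^sup>2)"
    by (metis complex_norm_square mult.commute)
  finally have "0 \<le> Re (\<phi> (star x * x)) - 2 * (cmod g)\<^sup>2 + (cmod g)\<^sup>2 * Re (\<phi> (star y * y))"
    using state_nonneg(2)[OF st, of "x - g *\<^sub>C y"] by simp
  moreover have "(cmod g)\<^sup>2 * Re (\<phi> (star y * y)) \<le> (cmod g)\<^sup>2 * 1"
    using y by (intro mult_left_mono) auto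
  ultimately show ?thesis
    by (simp add: g_def)
qed

lemma state_l2_sums:
  assumes st: "is_state \<phi>" and x: "x \<in> l2"
  shows "(\<lambda>j. Re (\<phi> (star (x j) * x j))) sums Re (\<phi> (l2_inner x x))"
    and "Re (\<phi> (l2_inner x x)) \<le> l2_sqnorm x"
proof -
  have bl: "bounded_linear (\<lambda>a. Re (\<phi> a))"
    by (rule bounded_linear_compose[OF bounded_linear_Re state_linear(1)[OF st]])
  have "summable (\<lambda>j. star (x j) * x j)"
    using x by (simp add: l2_def)
  from bounded_linear.sums[OF bl summable_sums[OF this]]
  show "(\<lambda>j. Re (\<phi> (star (x j) * x j))) sums Re (\<phi> (l2_inner x x))"
    by (simp add: l2_inner_def)
  show "Re (\<phi> (l2_inner x x)) \<le> l2_sqnorm x"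
    using state_norm_le[OF st, of "l2_inner x x"] complex_Re_le_cmod order_trans
    unfolding l2_sqnorm_def by blast
qed

section \<open>Seminorm estimates and finite nets\<close>

lemma tau_index_le_1:
  assumes "tau_index \<phi> y"
  shows "Re (\<phi> (star (y j) * y j)) \<le> 1"
  using cSUP_upper[of j UNIV "\<lambda>j. Re (\<phi> (star (y j) * y j))"] assms by (simp add: tau_index_def)

lemma tau_index_state: "tau_index \<phi> y \<Longrightarrow> is_state \<phi>"
  by (simp add: tau_index_def is_normal_state_def)

text \<open>Cauchy-Schwarz bounds the terms from index N on by the values of the state at
  \<open>star (x j) * x j\<close>, which add up to its value at the inner square of the
  tail.\<close>

lemma tau_seminorm_sq_le:
  assumes ti: "tau_index \<phi> y" and x: "x \<in> l2"
  shows "(tau_seminorm \<phi> y x)\<^sup>2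
    \<le> (\<Sum>j<N. (cmod (\<phi> (star (y j) * x j)))\<^sup>2) + l2_sqnorm (l2_tail N x)"
proof -
  note st = tau_index_state[OF ti]
  define a where "a = (\<lambda>j. (cmod (\<phi> (star (y j) * x j)))\<^sup>2)"
  define r where "r = (\<lambda>j. Re (\<phi> (star (l2_tail N x j) * l2_tail N x j)))"
  have a: "a j \<le> Re (\<phi> (star (x j) * x j))" for j
    unfolding a_def by (rule state_Cauchy_Schwarz[OF st tau_index_le_1[OF ti]])
  have "summable a"
    by (rule summable_comparison_test'[OF sums_summable[OF state_l2_sums(1)[OF st x]], of 0])
      (use a in \<open>simp add: a_def\<close>)
  have "(\<lambda>j. (if j \<in> {..<N} then a j else 0) + r j) sums
      (sum a {..<N} + Re (\<phi> (l2_inner (l2_tail N x) (l2_tail N x))))"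
    unfolding r_def by (intro sums_add sums_If_finite_set state_l2_sums[OF st] l2_tail_in_l2 x) simp
  moreover have "a j \<le> (if j \<in> {..<N} then a j else 0) + r j" for j
    using a[of j] state_nonneg(2)[OF st, of 0] by (cases "j < N") (simp_all add: r_def l2_tail_def)
  ultimately have "suminf a \<le> sum a {..<N} + Re (\<phi> (l2_inner (l2_tail N x) (l2_tail N x)))"
    by (intro sums_le[OF _ summable_sums[OF \<open>summable a\<close>]]) auto
  \<comment> \<open>Summability makes the sum in the seminorm genuine and nonnegative, so that
    squaring undoes the root.\<close>
  moreover have "(tau_seminorm \<phi> y x)\<^sup>2 = suminf a"
    using \<open>summable a\<close> by (simp add: tau_seminorm_def a_def suminf_nonneg)
  ultimately show ?thesis
    using state_l2_sums(2)[OF st l2_tail_in_l2[OF x], of N] by (simp add: a_def)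
qed

text \<open>Round each coordinate to a finite d / 2 net: points with the same rounded tuple are
  d-close. Keeping one point of V per occurring tuple puts the centres in V, so they too will have
  small tails.\<close>

lemma finite_net_coordinates:
  fixes f :: "nat \<Rightarrow> 'b \<Rightarrow> complex"
  assumes bdd: "\<And>j. bounded (f j ` V)" and d: "0 < d"
  shows "\<exists>C. finite C \<and> C \<subseteq> V \<and> (\<forall>x\<in>V. \<exists>c\<in>C. \<forall>j<N. cmod (f j c - f j x) < d)"
proof -
  have "\<exists>D. finite D \<and> f j ` V \<subseteq> (\<Union>p\<in>D. ball p (d / 2))" for j
  proof -
    have "compact (closure (f j ` V))"
      using bdd[of j] by (simp add: compact_closure)
    then obtain D where "finite D" "closure (f j ` V) \<subseteq> (\<Union>p\<in>D. ball p (d / 2))"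
      unfolding compact_eq_totally_bounded using d by (meson half_gt_zero)
    then show ?thesis
      by (meson closure_subset subset_trans)
  qed
  then obtain D where D: "\<And>j. finite (D j)" "\<And>j. f j ` V \<subseteq> (\<Union>p\<in>D j. ball p (d / 2))"
    by metis
  have "\<forall>j. \<forall>x\<in>V. \<exists>p\<in>D j. dist p (f j x) < d / 2"
    using D(2) by fastforce
  then obtain g where g: "\<And>j x. x \<in> V \<Longrightarrow> g j x \<in> D j" "\<And>j x. x \<in> V \<Longrightarrow> dist (g j x) (f j x) < d / 2"
    by metis
  define G where "G = (\<lambda>x. restrict (\<lambda>j. g j x) {..<N})"
  have "G ` V \<subseteq> Pi\<^sub>E {..<N} D"
    using g(1) by (simp add: image_subset_iff G_def restrict_PiE_iff)
  then have "finite (G ` V)"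
    by (rule finite_subset) (simp add: finite_PiE D(1))
  from finite_subset_image[OF this subset_refl]
  obtain C where C: "C \<subseteq> V" "finite C" "G ` V = G ` C"
    by (elim exE conjE)
  have "\<exists>c\<in>C. \<forall>j<N. cmod (f j c - f j x) < d" if x: "x \<in> V" for x
  proof -
    obtain c where c: "c \<in> C" "G x = G c"
      using C(3) x by blast
    have "cmod (f j c - f j x) < d" if "j < N" for j
    proof -
      have "g j x = g j c"
        using c(2) that by (metis G_def lessThan_iff restrict_apply')
      then have "dist (f j c) (g j x) < d / 2" "dist (g j x) (f j x) < d / 2"
        using g(2)[of c j] g(2)[OF x, of j] c(1) C(1) by (auto simp: dist_commute)
      then show ?thesis
        using dist_triangle[of "f j c" "f j x" "g j x"] by (simp add: dist_norm)
    qed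
    then show ?thesis
      using c(1) by blast
  qed
  then show ?thesis
    using C by blast
qed

lemma tau_totally_bounded_of_small_tails:
  fixes V :: "(nat \<Rightarrow> 'a::cstar_algebra) set"
  assumes V: "V \<subseteq> l2" and bdd: "\<And>x. x \<in> V \<Longrightarrow> l2_sqnorm x \<le> K"
    and tail: "\<And>e. 0 < e \<Longrightarrow> \<exists>N. \<forall>x\<in>V. l2_sqnorm (l2_tail N x) \<le> e"
  shows "tau_totally_bounded V"
  unfolding tau_totally_bounded_def
proof (intro allI impI)
  fix \<phi> :: "'a \<Rightarrow> complex" and y and \<epsilon> :: real
  assume ti: "tau_index \<phi> y" and \<epsilon>: "0 < \<epsilon>"
  note st = tau_index_state[OF ti]
  interpret \<phi>: bounded_linear \<phi>
    by (rule state_linear(1)[OF st])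
  \<comment> \<open>Two tails of this size give a quarter of the squared radius for the tail of a
    difference, by \<open>l2_diff\<close>.\<close>
  obtain N where N: "\<And>x. x \<in> V \<Longrightarrow> l2_sqnorm (l2_tail N x) \<le> \<epsilon>\<^sup>2 / 16"
    using tail[of "\<epsilon>\<^sup>2 / 16"] \<epsilon> by auto
  \<comment> \<open>N squared coordinate errors contribute at most another quarter; the added 1
    covers N = 0.\<close>
  define d where "d = \<epsilon> / (2 * sqrt (real N + 1))"
  have d: "0 < d" "real N * d\<^sup>2 \<le> \<epsilon>\<^sup>2 / 4"
    using \<epsilon> by (simp_all add: d_def power_divide power_mult_distrib field_simps)
  have "bounded ((\<lambda>x. \<phi> (star (y j) * x j)) ` V)" for j
  proof (rule boundedI)
    fix w assume "w \<in> (\<lambda>x. \<phi> (star (y j) * x j)) ` V"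
    then obtain x where x: "x \<in> V" and w: "w = \<phi> (star (y j) * x j)"
      by blast
    have xl2: "x \<in> l2"
      using V x by blast
    have "(cmod w)\<^sup>2 \<le> Re (\<phi> (star (x j) * x j))"
      unfolding w by (rule state_Cauchy_Schwarz[OF st tau_index_le_1[OF ti]])
    also have "\<dots> \<le> Re (\<phi> (l2_inner x x))"
      using sum_le_suminf[OF sums_summable[OF state_l2_sums(1)[OF st xl2]], of "{j}"]
        state_nonneg(2)[OF st] sums_unique[OF state_l2_sums(1)[OF st xl2]] by simp
    also have "\<dots> \<le> K"
      using state_l2_sums(2)[OF st xl2] bdd[OF x] by simp
    finally show "norm w \<le> sqrt K"
      by (rule real_le_rsqrt)
  qed
  from finite_net_coordinates[where N = N and f = "\<lambda>j x. \<phi> (star (y j) * x j)", OF this d(1)]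
  obtain C where C: "finite C" "C \<subseteq> V"
    "\<And>x. x \<in> V \<Longrightarrow> \<exists>c\<in>C. \<forall>j<N. cmod (\<phi> (star (y j) * c j) - \<phi> (star (y j) * x j)) < d"
    by blast
  have "\<exists>c\<in>C. tau_seminorm \<phi> y (\<lambda>j. c j - x j) < \<epsilon>" if x: "x \<in> V" for x
  proof -
    obtain c where c: "c \<in> C"
        "\<And>j. j < N \<Longrightarrow> cmod (\<phi> (star (y j) * c j) - \<phi> (star (y j) * x j)) < d"
      using C(3)[OF x] by blast
    have l2: "c \<in> l2" "x \<in> l2"
      using C(2) V x c(1) by auto
    have "(\<Sum>j<N. (cmod (\<phi> (star (y j) * (c j - x j))))\<^sup>2) \<le> real (card {..<N}) * d\<^sup>2"
    proof (rule sum_bounded_above)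
      fix j assume "j \<in> {..<N}"
      then show "(cmod (\<phi> (star (y j) * (c j - x j))))\<^sup>2 \<le> d\<^sup>2"
        using c(2)[of j] by (intro power_mono) (simp_all add: right_diff_distrib \<phi>.diff)
    qed
    moreover have "l2_sqnorm (l2_tail N (\<lambda>j. c j - x j)) \<le> 2 * (\<epsilon>\<^sup>2 / 16) + 2 * (\<epsilon>\<^sup>2 / 16)"
      unfolding l2_tail_diff
      using l2_diff(2)[OF l2_tail_in_l2[OF l2(1)] l2_tail_in_l2[OF l2(2)], of N N]
        N[OF subsetD[OF C(2) c(1)]] N[OF x] by linarith
    ultimately have "(tau_seminorm \<phi> y (\<lambda>j. c j - x j))\<^sup>2 \<le> \<epsilon>\<^sup>2 / 4 + \<epsilon>\<^sup>2 / 4"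
      using tau_seminorm_sq_le[OF ti l2_diff(1)[OF l2], of N] d(2) by simp
    also have "\<dots> < \<epsilon>\<^sup>2"
      using \<epsilon> by simp
    finally have "tau_seminorm \<phi> y (\<lambda>j. c j - x j) < \<epsilon>"
      by (rule power2_less_imp_less) (use \<epsilon> in simp)
    then show ?thesis
      using c(1) by blast
  qed
  then show "\<exists>C. finite C \<and> C \<subseteq> l2 \<and>
      V \<subseteq> (\<Union>c\<in>C. {x \<in> l2. tau_seminorm \<phi> y (\<lambda>j. c j - x j) < \<epsilon>})"
    using C(1,2) V by (intro exI[of _ C]) blast
qed

theorem theorem4p5:
  fixes J :: "'a::cstar_algebra \<Rightarrow> 'p::complex_banach \<Rightarrow> complex"
    and T :: "'a l2_op"
  assumes "wstar_algebra_via J"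
    and "T \<in> quoted_compact_ops"
  shows "tau_compact_op T"
  unfolding tau_compact_op_def
proof (intro allI impI)
  fix S :: "(nat \<Rightarrow> 'a) set"
  assume "l2_norm_bounded S"
  then obtain R where S: "S \<subseteq> l2" and "\<And>x. x \<in> S \<Longrightarrow> l2_norm x \<le> R"
    unfolding l2_norm_bounded_def by blast
  \<comment> \<open>Positive even if R is not, so that S can be scaled into the unit ball.\<close>
  moreover define r where "r = \<bar>R\<bar> + 1"
  ultimately have r: "0 < r" "\<And>x. x \<in> S \<Longrightarrow> l2_norm x \<le> r"
    by fastforce+
  have T: "x \<in> l2 \<Longrightarrow> T x \<in> l2" "x \<in> l2 \<Longrightarrow> T (\<lambda>j. x j * a) = (\<lambda>j. T x j * a)" for x a
    using assms(2) by (simp_all add: quoted_compact_ops_def adjointable_ops_def)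
  obtain K where K: "\<And>x. x \<in> l2 \<Longrightarrow> l2_norm (T x) \<le> K * l2_norm x"
    using assms(2) unfolding quoted_compact_ops_def adjointable_ops_def by blast
  show "tau_totally_bounded (T ` S)"
  proof (rule tau_totally_bounded_of_small_tails)
    show "T ` S \<subseteq> l2"
      using T(1) S by blast
    fix u assume "u \<in> T ` S"
    then obtain x where x: "x \<in> S" "u = T x"
      by blast
    have "l2_norm u \<le> K * l2_norm x"
      using K x S by blast
    also have "\<dots> \<le> \<bar>K\<bar> * r"
      using r(2)[OF x(1)] by (intro mult_mono) (auto simp: l2_norm_def)
    finally show "l2_sqnorm u \<le> (\<bar>K\<bar> * r)\<^sup>2"
      unfolding l2_sqnorm_eq by (rule power_mono) (simp add: l2_norm_def)
  next
    fix e :: real assume "0 < e"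
    \<comment> \<open>Dividing by r^2 compensates for the factor that scaling back puts on the
      squared norm.\<close>
    then obtain N where N: "\<And>x. x \<in> l2 \<Longrightarrow> l2_norm x \<le> 1 \<Longrightarrow> l2_sqnorm (l2_tail N (T x)) \<le> e / r\<^sup>2"
      using quoted_compact_small_tails[OF assms(2), of "e / r\<^sup>2"] r(1) by auto
    have "l2_sqnorm (l2_tail N (T x)) \<le> e" if x: "x \<in> S" for x
    proof -
      \<comment> \<open>The scaling is a right multiplication by an algebra element, the form of
        homogeneity that \<open>adjointable_ops\<close> provides.\<close>
      define v where "v = (\<lambda>j. x j * of_real (1 / r))"
      have xl2: "x \<in> l2"
        using x S by blast
      have "l2_sqnorm x \<le> r\<^sup>2"
        unfolding l2_sqnorm_eq using r(2)[OF x] by (rule power_mono) (simp add: l2_norm_def)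
      then have "(norm (of_real (1 / r) :: 'a))\<^sup>2 * l2_sqnorm x \<le> 1"
        using r(1) by (simp add: norm_divide power_divide)
      then have v: "v \<in> l2" "l2_norm v \<le> 1"
        using l2_mult_right[OF xl2, of "of_real (1 / r)"] by (simp_all add: v_def l2_norm_le_1_iff)
      have "T x = (\<lambda>j. T v j * of_real r)"
        using T(2)[OF xl2, of "of_real (1 / r)"] r(1)
        by (simp add: v_def mult.assoc flip: of_real_mult)
      then have "l2_sqnorm (l2_tail N (T x)) \<le> (norm (of_real r :: 'a))\<^sup>2 * l2_sqnorm (l2_tail N (T v))"
        using l2_mult_right(2)[OF l2_tail_in_l2[OF T(1)[OF v(1)]], of N "of_real r"]
        by (simp add: l2_tail_mult_right)
      also have "\<dots> \<le> r\<^sup>2 * (e / r\<^sup>2)"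
        using N[OF v] by (intro mult_mono) (simp_all add: l2_sqnorm_nonneg)
      finally show ?thesis
        using r(1) by simp
    qed
    then show "\<exists>N. \<forall>u\<in>T ` S. l2_sqnorm (l2_tail N u) \<le> e"
      by blast
  qed
qed

end
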